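(* Let $\Omega\subset\mathbb{R}^n$ be a non-empty open subset. The elements of $C^\infty(\Omega)$ form a grid of equidistant points in $\mathcal{G}(\Omega)$, i.e. $D(f,g)$ has one and the same positive value for all pairs of distinct $f,g\in C^\infty(\Omega)$. In particular, $\mathcal{G}(\Omega)$ is a fractal.
   Context: $I=]0,1]$. $\mathcal{G}(\Omega)$ is the simplified Colombeau algebra: nets $(f_\varepsilon)_{\varepsilon\in I}$ of $C^\infty$ functions on $\Omega$ such that for each compact $K\subset\Omega$ and multi-index $\beta$, $\sup_K|\partial^\beta f_\varepsilon|<\varepsilon^{r}$ for some $r\in\mathbb{R}$ and all small $\varepsilon$, modulo nets for which this holds for every $K$, $\beta$ and every $r\in\mathbb{N}$. $C^\infty(\Omega)$ is embedded in $\mathcal{G}(\Omega)$ diagonally, by constant nets. Metric: fix an exhaustion $(\Omega_m)_{m\in\mathbb{N}}$ of $\Omega$ by relatively compact open subsets. For $f=[(f_\varepsilon)]$ put $V_{mp}(f)=\sup\{a\in\mathbb{R}:\forall|\beta|\le p,\ \sup_{\Omega_m}|\partial^\beta f_\varepsilon|=o(\varepsilon^a)\ (\varepsilon\to0)\}$, $D_{mp}(f,g)=\exp(-V_{mp}(f-g))$ (with $e^{-\infty}=0$), and $D(f,g)=\sup_m\frac{2D_{mm}(f,g)}{1+D_{mm}(f,g)}$; this metric induces the sharp topology. A metric space is called a fractal if its Hausdorff dimension is strictly larger than its topological (inductive) dimension $Ind$. *)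

theory Defs
  imports "HOL-Analysis.Analysis" "HOL-Library.Landau_Symbols"
begin

section \<open>Smooth functions on an open subset of Euclidean space\<close>

text \<open>
  The scalars range over an arbitrary type of class \<^class>\<open>real_normed_field\<close>; by the theorem of
  Gelfand and Mazur these are exactly the real and the complex numbers.
  Functions on an open set \<open>\<Omega>\<close> are represented by total functions whose values outside \<open>\<Omega>\<close>
  are irrelevant, so that two of them are equal as functions on \<open>\<Omega>\<close> iff they agree on \<open>\<Omega>\<close>.
\<close>

definition partial :: "'n::finite \<Rightarrow> (real^'n \<Rightarrow> 'k::real_normed_field) \<Rightarrow> real^'n \<Rightarrow> 'k" where
  "partial i f x = vector_derivative (\<lambda>t::real. f (x + t *\<^sub>R axis i 1)) (at 0)"

primrec Ck_on :: "nat \<Rightarrow> (real^'n::finite) set \<Rightarrow> (real^'n \<Rightarrow> 'k::real_normed_field) \<Rightarrow> bool" where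
  "Ck_on 0 \<Omega> f \<longleftrightarrow> continuous_on \<Omega> f"
| "Ck_on (Suc k) \<Omega> f \<longleftrightarrow> f differentiable_on \<Omega> \<and> (\<forall>i. Ck_on k \<Omega> (partial i f))"

definition Cinf :: "(real^'n::finite) set \<Rightarrow> (real^'n \<Rightarrow> 'k::real_normed_field) set" where
  "Cinf \<Omega> = {f. \<forall>k. Ck_on k \<Omega> f}"

text \<open>
  A multi-index is a function \<open>\<beta> :: 'n \<Rightarrow> nat\<close>. The index type carries no order, so the order in
  which the coordinate derivatives are applied is fixed by choosing an enumeration of the indices;
  on smooth functions the choice is irrelevant.
\<close>

definition coords :: "'n::finite list" where
  "coords = (SOME is. distinct is \<and> set is = UNIV)"

definition mpartial :: "('n::finite \<Rightarrow> nat) \<Rightarrow> (real^'n \<Rightarrow> 'k::real_normed_field) \<Rightarrow> real^'n \<Rightarrow> 'k" where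
  "mpartial \<beta> f = foldr (\<lambda>i. partial i ^^ \<beta> i) coords f"

definition morder :: "('n::finite \<Rightarrow> nat) \<Rightarrow> nat" where
  "morder \<beta> = (\<Sum>i\<in>UNIV. \<beta> i)"

text \<open>
  A supremum of non-negative quantities, hence 0 on the empty set. It is only used where the
  function is continuous on a compact set containing \<open>S\<close>, so it is finite.
\<close>

definition supnorm :: "'a set \<Rightarrow> ('a \<Rightarrow> 'k::real_normed_field) \<Rightarrow> real" where
  "supnorm S f = (if S = {} then 0 else SUP x\<in>S. norm (f x))"


section \<open>The simplified Colombeau algebra\<close>

text \<open>Only the members of a net with index in \<open>]0,1]\<close> are relevant.\<close>

type_synonym ('n, 'k) net = "real \<Rightarrow> real^'n \<Rightarrow> 'k"

definition smooth_nets :: "(real^'n::finite) set \<Rightarrow> ('n, 'k::real_normed_field) net set" where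
  "smooth_nets \<Omega> = {u. \<forall>\<epsilon>\<in>{0<..1}. u \<epsilon> \<in> Cinf \<Omega>}"

definition moderate :: "(real^'n::finite) set \<Rightarrow> ('n, 'k::real_normed_field) net set" where
  "moderate \<Omega> = {u \<in> smooth_nets \<Omega>. \<forall>K \<beta>. compact K \<and> K \<subseteq> \<Omega> \<longrightarrow>
     (\<exists>r::real. \<forall>\<^sub>F \<epsilon> in at_right 0. supnorm K (mpartial \<beta> (u \<epsilon>)) < \<epsilon> powr r)}"

definition negligible_nets :: "(real^'n::finite) set \<Rightarrow> ('n, 'k::real_normed_field) net set" where
  "negligible_nets \<Omega> = {u \<in> smooth_nets \<Omega>. \<forall>K \<beta>. compact K \<and> K \<subseteq> \<Omega> \<longrightarrow>
     (\<forall>r::nat. \<forall>\<^sub>F \<epsilon> in at_right 0. supnorm K (mpartial \<beta> (u \<epsilon>)) < \<epsilon> ^ r)}"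

definition net_diff :: "('n::finite, 'k::real_normed_field) net \<Rightarrow> ('n, 'k) net \<Rightarrow> ('n, 'k) net" where
  "net_diff u v = (\<lambda>\<epsilon> x. u \<epsilon> x - v \<epsilon> x)"

definition net_rel :: "(real^'n::finite) set \<Rightarrow> (('n, 'k::real_normed_field) net \<times> ('n, 'k) net) set" where
  "net_rel \<Omega> = {(u, v). u \<in> moderate \<Omega> \<and> v \<in> moderate \<Omega> \<and> net_diff u v \<in> negligible_nets \<Omega>}"

definition Colombeau :: "(real^'n::finite) set \<Rightarrow> ('n, 'k::real_normed_field) net set set" where
  "Colombeau \<Omega> = moderate \<Omega> // net_rel \<Omega>"

definition diag_embed :: "(real^'n::finite) set \<Rightarrow> (real^'n \<Rightarrow> 'k::real_normed_field) \<Rightarrow> ('n, 'k) net set" where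
  "diag_embed \<Omega> f = net_rel \<Omega> `` {\<lambda>\<epsilon>. f}"


section \<open>The metric\<close>

definition exhaustion :: "(real^'n::finite) set \<Rightarrow> (nat \<Rightarrow> (real^'n) set) \<Rightarrow> bool" where
  "exhaustion \<Omega> W \<longleftrightarrow>
     (\<forall>m. open (W m) \<and> compact (closure (W m)) \<and> closure (W m) \<subseteq> \<Omega> \<and> W m \<subseteq> W (Suc m)) \<and>
     (\<Union>m. W m) = \<Omega>"

definition valuation ::
  "(nat \<Rightarrow> (real^'n::finite) set) \<Rightarrow> nat \<Rightarrow> nat \<Rightarrow> ('n, 'k::real_normed_field) net \<Rightarrow> ereal" where
  "valuation W m p u = Sup (ereal ` {a. \<forall>\<beta>. morder \<beta> \<le> p \<longrightarrow>
     (\<lambda>\<epsilon>. supnorm (W m) (mpartial \<beta> (u \<epsilon>))) \<in> o[at_right 0](\<lambda>\<epsilon>. \<epsilon> powr a)})"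

text \<open>The value \<open>-\<infinity>\<close> of the valuation does not occur on moderate nets.\<close>

definition seminorm ::
  "(nat \<Rightarrow> (real^'n::finite) set) \<Rightarrow> nat \<Rightarrow> nat \<Rightarrow> ('n, 'k::real_normed_field) net \<Rightarrow> real" where
  "seminorm W m p u =
     (if valuation W m p u = \<infinity> then 0 else exp (- real_of_ereal (valuation W m p u)))"

definition net_dist ::
  "(nat \<Rightarrow> (real^'n::finite) set) \<Rightarrow> ('n, 'k::real_normed_field) net \<Rightarrow> ('n, 'k) net \<Rightarrow> real" where
  "net_dist W u v =
     (SUP m. 2 * seminorm W m m (net_diff u v) / (1 + seminorm W m m (net_diff u v)))"

text \<open>The distance does not depend on the chosen representatives.\<close>

definition Colombeau_dist ::
  "(nat \<Rightarrow> (real^'n::finite) set) \<Rightarrow> ('n, 'k::real_normed_field) net set \<Rightarrow> ('n, 'k) net set \<Rightarrow> real" where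
  "Colombeau_dist W F G = net_dist W (SOME u. u \<in> F) (SOME v. v \<in> G)"


section \<open>Hausdorff dimension, large inductive dimension, fractals\<close>

definition mdiam :: "('a \<Rightarrow> 'a \<Rightarrow> real) \<Rightarrow> 'a set \<Rightarrow> ennreal" where
  "mdiam d U = (SUP x\<in>U. SUP y\<in>U. ennreal (d x y))"

text \<open>
  The \<open>s\<close>-th power of a finite diameter, with the conventions that the empty set contributes 0
  and that \<open>0\<^sup>0 = 1\<close> for non-empty sets (whereas \<open>0 powr 0 = 0\<close>).
\<close>

definition diam_pow :: "('a \<Rightarrow> 'a \<Rightarrow> real) \<Rightarrow> real \<Rightarrow> 'a set \<Rightarrow> ennreal" where
  "diam_pow d s U =
     (if U = {} then 0 else if s = 0 then 1 else ennreal (enn2real (mdiam d U) powr s))"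

definition Hausdorff_pre :: "'a set \<Rightarrow> ('a \<Rightarrow> 'a \<Rightarrow> real) \<Rightarrow> real \<Rightarrow> real \<Rightarrow> ennreal" where
  "Hausdorff_pre M d s \<delta> = Inf {(\<Sum>i. diam_pow d s (U i)) | U :: nat \<Rightarrow> 'a set.
     (\<forall>i. U i \<subseteq> M \<and> mdiam d (U i) \<le> ennreal \<delta>) \<and> M \<subseteq> (\<Union>i. U i)}"

definition Hausdorff_measure :: "'a set \<Rightarrow> ('a \<Rightarrow> 'a \<Rightarrow> real) \<Rightarrow> real \<Rightarrow> ennreal" where
  "Hausdorff_measure M d s = (SUP \<delta>\<in>{0<..}. Hausdorff_pre M d s \<delta>)"

definition Hausdorff_dim :: "'a set \<Rightarrow> ('a \<Rightarrow> 'a \<Rightarrow> real) \<Rightarrow> ereal" where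
  "Hausdorff_dim M d = Inf (ereal ` {s. 0 \<le> s \<and> Hausdorff_measure M d s = 0})"

text \<open>
  \<open>Ind_le X n\<close> means \<open>Ind X \<le> n\<close>. The library's \<^const>\<open>dimension_le\<close> is the small inductive
  dimension, in which the closed set \<open>A\<close> below is a single point.
\<close>

inductive Ind_le :: "'a topology \<Rightarrow> int \<Rightarrow> bool" where
  empty: "topspace X = {} \<Longrightarrow> Ind_le X (-1)"
| step: "0 \<le> n \<Longrightarrow>
    (\<And>A V. closedin X A \<Longrightarrow> openin X V \<Longrightarrow> A \<subseteq> V \<Longrightarrow>
       \<exists>U. openin X U \<and> A \<subseteq> U \<and> U \<subseteq> V \<and> Ind_le (subtopology X (X frontier_of U)) (n - 1)) \<Longrightarrow>
    Ind_le X n"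

definition Ind :: "'a topology \<Rightarrow> ereal" where
  "Ind X = Inf ((\<lambda>n. ereal (of_int n)) ` {n. Ind_le X n})"

text \<open>
  The locale \<^locale>\<open>Metric_space\<close> asks for non-negativity and symmetry of the distance also outside
  the carrier, where a distance between equivalence classes has no meaning; hence the restriction.
\<close>

definition restrict_dist :: "'a set \<Rightarrow> ('a \<Rightarrow> 'a \<Rightarrow> real) \<Rightarrow> 'a \<Rightarrow> 'a \<Rightarrow> real" where
  "restrict_dist M d x y = (if x \<in> M \<and> y \<in> M then d x y else 0)"

definition fractal :: "'a set \<Rightarrow> ('a \<Rightarrow> 'a \<Rightarrow> real) \<Rightarrow> bool" where
  "fractal M d \<longleftrightarrow> Metric_space M (restrict_dist M d) \<and>
     Ind (Metric_space.mtopology M (restrict_dist M d)) < Hausdorff_dim M d"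

end

theory Submission
  imports Defs
begin

text \<open>
  The distance is an ultrametric: each valuation satisfies \<open>V(f + g) \<ge> min (V f) (V g)\<close>, and
  \<open>t \<mapsto> 2 t / (1 + t)\<close> is monotone. Hence \<open>\<G>(\<Omega>)\<close> has large inductive dimension at most 0.
  For a constant net \<open>h\<close> the valuation is never negative, and it is 0 as soon as
  \<open>h\<close> does not vanish on \<open>\<Omega>\<^sub>m\<close>; so distinct smooth functions have distance \<open>2 \<cdot> 1 / (1 + 1) = 1\<close>.
  The constant functions thus form an uncountable equidistant set, which no
  countable family of sets of small diameter covers, and the Hausdorff dimension is infinite.
\<close>

section \<open>Differences of smooth functions\<close>

text \<open>Values outside \<Omega> are arbitrary, so \<open>h\<close> is compared with
  \<open>f - g\<close> on \<Omega> only. Openness keeps the coordinate line through \<open>x\<close>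
  inside \<Omega> for small \<open>t\<close>, and the derivative at 0 sees nothing else.\<close>

lemma partial_diff_on:
  fixes f g h :: "real^'n::finite \<Rightarrow> 'k::real_normed_field"
  assumes "open \<Omega>" "f differentiable_on \<Omega>" "g differentiable_on \<Omega>"
    and h: "\<And>x. x \<in> \<Omega> \<Longrightarrow> h x = f x - g x" and x: "x \<in> \<Omega>"
  shows "partial i h x = partial i f x - partial i g x"
proof -
  let ?l = "\<lambda>t::real. x + t *\<^sub>R axis i 1"
  have d: "(\<lambda>t. u (?l t)) differentiable at 0"
    if "u differentiable_on \<Omega>" for u :: "real^'n \<Rightarrow> 'k"
  proof -
    have "u differentiable at (?l 0)"
      using that x assms(1) by (simp add: differentiable_on_eq_differentiable_at)
    moreover have "?l differentiable at 0"
      by (auto intro!: derivative_intros)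
    ultimately show ?thesis
      using differentiable_chain_at[of ?l 0 u] by (simp add: o_def)
  qed
  have "((\<lambda>t. ?l t) \<longlongrightarrow> ?l 0) (nhds 0)"
    by (intro tendsto_intros filterlim_ident)
  hence "\<forall>\<^sub>F t in nhds 0. ?l t \<in> \<Omega>"
    using assms(1) x by (intro topological_tendstoD[of ?l "?l 0"]) auto
  hence "\<forall>\<^sub>F t in nhds 0. t \<in> UNIV \<longrightarrow> h (?l t) = f (?l t) - g (?l t)"
    by eventually_elim (simp add: h)
  hence "partial i h x = vector_derivative (\<lambda>t. f (?l t) - g (?l t)) (at 0)"
    unfolding partial_def by (intro vector_derivative_cong_eq) auto
  also have "\<dots> = partial i f x - partial i g x"
    unfolding partial_def using assms d by (intro vector_derivative_diff_at) auto
  finally show ?thesis .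
qed

text \<open>A separate \<open>h\<close> instead of the literal difference makes the induction work:
  \<open>partial i h\<close> is known to be the difference of the partial derivatives only on
  \<Omega>.\<close>

lemma Ck_on_diff:
  fixes f g h :: "real^'n::finite \<Rightarrow> 'k::real_normed_field"
  assumes "open \<Omega>" "Ck_on k \<Omega> f" "Ck_on k \<Omega> g" "\<And>x. x \<in> \<Omega> \<Longrightarrow> h x = f x - g x"
  shows "Ck_on k \<Omega> h"
  using assms(2-)
proof (induction k arbitrary: f g h)
  case 0
  hence "continuous_on \<Omega> (\<lambda>x. f x - g x)"
    by (auto intro: continuous_intros)
  thus ?case
    using 0 continuous_on_cong[of \<Omega> \<Omega> h "\<lambda>x. f x - g x"] by simp
next
  case (Suc k)
  have "(\<lambda>x. f x - g x) differentiable_on \<Omega>"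
    using Suc.prems by (auto intro: differentiable_on_diff)
  hence "h differentiable_on \<Omega>"
    using Suc.prems(3) unfolding differentiable_on_def differentiable_def
    by (metis (no_types, lifting) has_derivative_transform)
  moreover have "Ck_on k \<Omega> (partial i h)" for i
  proof (rule Suc.IH)
    show "Ck_on k \<Omega> (partial i f)" "Ck_on k \<Omega> (partial i g)"
      using Suc.prems by auto
    show "partial i h x = partial i f x - partial i g x" if "x \<in> \<Omega>" for x
      using Suc.prems that by (intro partial_diff_on[OF assms(1)]) auto
  qed
  ultimately show ?case by simp
qed

lemma Ck_on_const: "Ck_on k \<Omega> (\<lambda>x::real^'n::finite. c::'k::real_normed_field)"
proof (induction k arbitrary: c)
  case (Suc k)
  have "partial i (\<lambda>x::real^'n. c) = (\<lambda>x. 0)" for i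
    by (auto simp: partial_def)
  thus ?case using Suc by simp
qed simp

lemma Cinf_const: "(\<lambda>x. c) \<in> Cinf \<Omega>"
  by (simp add: Cinf_def Ck_on_const)

lemma Cinf_diff:
  assumes "open \<Omega>" "f \<in> Cinf \<Omega>" "g \<in> Cinf \<Omega>"
  shows "(\<lambda>x. f x - g x) \<in> Cinf \<Omega>"
  using assms by (auto simp: Cinf_def intro: Ck_on_diff[of _ _ f g])

lemma Cinf_imp_continuous_on: "f \<in> Cinf \<Omega> \<Longrightarrow> continuous_on \<Omega> f"
  unfolding Cinf_def by (auto dest: spec[of _ 0])

lemma Cinf_imp_differentiable_on: "f \<in> Cinf \<Omega> \<Longrightarrow> f differentiable_on \<Omega>"
  unfolding Cinf_def by (auto dest: spec[of _ "Suc 0"])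

lemma Cinf_partial: "f \<in> Cinf \<Omega> \<Longrightarrow> partial i f \<in> Cinf \<Omega>"
  unfolding Cinf_def
proof clarify
  fix k assume "\<forall>k. Ck_on k \<Omega> f"
  hence "Ck_on (Suc k) \<Omega> f" by blast
  thus "Ck_on k \<Omega> (partial i f)" by simp
qed

lemma Cinf_mpartial:
  assumes "f \<in> Cinf \<Omega>"
  shows "mpartial \<beta> f \<in> Cinf \<Omega>"
proof -
  have pow: "(partial i ^^ k) f \<in> Cinf \<Omega>" if "f \<in> Cinf \<Omega>" for i k f
    using that by (induction k) (auto intro: Cinf_partial)
  have "foldr (\<lambda>i. partial i ^^ \<beta> i) is f \<in> Cinf \<Omega>" for "is"
    using assms by (induction "is") (auto intro: pow)
  thus ?thesis by (simp add: mpartial_def)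
qed

text \<open>The relation \<open>R\<close>, "the third function is the difference of two smooth ones
  on \<Omega>", survives each coordinate derivative. The induction runs over an arbitrary list,
  since \<open>coords\<close> is known only through a choice.\<close>

lemma mpartial_diff:
  fixes f g :: "real^'n::finite \<Rightarrow> 'k::real_normed_field"
  assumes "open \<Omega>" "f \<in> Cinf \<Omega>" "g \<in> Cinf \<Omega>" "x \<in> \<Omega>"
  shows "mpartial \<beta> (\<lambda>x. f x - g x) x = mpartial \<beta> f x - mpartial \<beta> g x"
proof -
  define R where "R u v w \<longleftrightarrow> u \<in> Cinf \<Omega> \<and> v \<in> Cinf \<Omega> \<and> (\<forall>x\<in>\<Omega>. w x = u x - v x)"
    for u v w :: "real^'n \<Rightarrow> 'k"
  have step: "R (partial i u) (partial i v) (partial i w)" if "R u v w" for i u v w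
    using that unfolding R_def
    by (auto intro!: Cinf_partial partial_diff_on[OF assms(1)] Cinf_imp_differentiable_on)
  have pow: "R ((partial i ^^ k) u) ((partial i ^^ k) v) ((partial i ^^ k) w)"
    if "R u v w" for i k u v w
    using that by (induction k) (auto intro: step)
  have "R f g (\<lambda>x. f x - g x)"
    using assms by (simp add: R_def)
  hence "R (foldr (\<lambda>i. partial i ^^ \<beta> i) is f) (foldr (\<lambda>i. partial i ^^ \<beta> i) is g)
      (foldr (\<lambda>i. partial i ^^ \<beta> i) is (\<lambda>x. f x - g x))" for "is"
    by (induction "is") (auto intro: pow)
  thus ?thesis
    using assms(4) by (simp add: R_def mpartial_def)
qed

text \<open>Writing 0 as 0 - 0 reduces this to the difference rule.\<close>

lemma mpartial_zero:
  assumes "open \<Omega>" "x \<in> \<Omega>"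
  shows "mpartial \<beta> (\<lambda>x::real^'n::finite. 0 :: 'k::real_normed_field) x = 0"
  using mpartial_diff[OF assms(1) Cinf_const Cinf_const assms(2), of \<beta> "0::'k" 0] by simp

lemma mpartial_order_zero: "mpartial (\<lambda>i. 0) f = f"
proof -
  have "foldr (\<lambda>i. partial i ^^ 0) is f = f" for "is"
    by (induction "is") auto
  thus ?thesis by (simp add: mpartial_def)
qed


section \<open>Suprema of norms\<close>

text \<open>\<open>0 \<le> B\<close> covers the empty \<open>S\<close>, on which
  \<open>supnorm\<close> is 0.\<close>

lemma supnorm_le:
  assumes "0 \<le> B" "\<And>x. x \<in> S \<Longrightarrow> norm (f x) \<le> B"
  shows "supnorm S f \<le> B"
  using assms by (auto simp: supnorm_def intro: cSUP_least)

lemma norm_le_supnorm: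
  assumes "bounded (f ` S)" "x \<in> S"
  shows "norm (f x) \<le> supnorm S f"
proof -
  have "bdd_above ((\<lambda>x. norm (f x)) ` S)"
    using assms(1) by (auto simp: bounded_iff bdd_above_def)
  thus ?thesis
    using assms(2) by (auto simp: supnorm_def intro: cSUP_upper)
qed

lemma supnorm_nonneg: "bounded (f ` S) \<Longrightarrow> 0 \<le> supnorm S f"
proof (cases "S = {}")
  case False
  assume "bounded (f ` S)"
  from False obtain x where "x \<in> S" by blast
  with norm_le_supnorm[OF \<open>bounded (f ` S)\<close> this] show ?thesis
    using norm_ge_zero[of "f x"] by linarith
qed (simp add: supnorm_def)

lemma supnorm_mono:
  assumes "bounded (f ` T)" "S \<subseteq> T"
  shows "supnorm S f \<le> supnorm T f"
  using assms by (intro supnorm_le supnorm_nonneg norm_le_supnorm) auto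

lemma supnorm_diff_le:
  assumes "bounded (f ` S)" "bounded (g ` S)" "\<And>x. x \<in> S \<Longrightarrow> h x = f x - g x"
  shows "supnorm S h \<le> supnorm S f + supnorm S g"
proof (rule supnorm_le)
  show "0 \<le> supnorm S f + supnorm S g"
    using assms by (simp add: supnorm_nonneg)
  show "norm (h x) \<le> supnorm S f + supnorm S g" if "x \<in> S" for x
    using assms that norm_le_supnorm[of f S x] norm_le_supnorm[of g S x]
      norm_triangle_ineq4[of "f x" "g x"] by simp
qed

text \<open>The members of the exhaustion are only relatively compact, so the bound comes from
  continuity on a compact \<open>K\<close> containing \<open>S\<close>.\<close>

lemma bounded_mpartial:
  assumes "f \<in> Cinf \<Omega>" "compact K" "K \<subseteq> \<Omega>" "S \<subseteq> K"
  shows "bounded (mpartial \<beta> f ` S)"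
proof -
  have "continuous_on K (mpartial \<beta> f)"
    using Cinf_imp_continuous_on[OF Cinf_mpartial[OF assms(1)]] assms(3)
    by (rule continuous_on_subset)
  hence "bounded (mpartial \<beta> f ` K)"
    using assms(2) by (intro compact_imp_bounded compact_continuous_image)
  thus ?thesis
    using image_mono[OF assms(4)] by (rule bounded_subset)
qed


section \<open>Nets\<close>

text \<open>Nets are constrained only for indices in \<open>{0<..1}\<close>; this fact restricts
  every asymptotic estimate to them.\<close>

lemma eventually_at_right_0_Ioc: "\<forall>\<^sub>F \<epsilon> in at_right 0. \<epsilon> \<in> {0<..1::real}"
  using eventually_at_right_real[OF zero_less_one] by (rule eventually_mono) auto

lemma tendsto_powr_at_right_0:
  assumes "0 < s"
  shows "((\<lambda>\<epsilon>::real. \<epsilon> powr s) \<longlongrightarrow> 0) (at_right 0)"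
proof (rule tendsto_zero_powrI)
  show "((\<lambda>\<epsilon>::real. \<epsilon>) \<longlongrightarrow> 0) (at_right 0)" by (rule tendsto_ident_at)
  show "\<forall>\<^sub>F \<epsilon>::real in at_right 0. 0 \<le> \<epsilon>"
    using eventually_at_right_0_Ioc by eventually_elim simp
qed (use assms in auto)

lemma powr_smallo_powr:
  assumes "a < b"
  shows "(\<lambda>\<epsilon>::real. \<epsilon> powr b) \<in> o[at_right 0](\<lambda>\<epsilon>. \<epsilon> powr a)"
proof (rule smalloI_tendsto)
  have "((\<lambda>\<epsilon>::real. \<epsilon> powr (b - a)) \<longlongrightarrow> 0) (at_right 0)"
    using assms by (intro tendsto_powr_at_right_0) simp
  thus "((\<lambda>\<epsilon>::real. \<epsilon> powr b / \<epsilon> powr a) \<longlongrightarrow> 0) (at_right 0)"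
    by (simp add: powr_diff)
  show "\<forall>\<^sub>F \<epsilon>::real in at_right 0. \<epsilon> powr a \<noteq> 0"
    using eventually_at_right_0_Ioc by eventually_elim simp
qed

lemma powr_bigo_powr:
  assumes "a \<le> b"
  shows "(\<lambda>\<epsilon>::real. \<epsilon> powr b) \<in> O[at_right 0](\<lambda>\<epsilon>. \<epsilon> powr a)"
  using assms powr_smallo_powr[of a b] landau_o.small_imp_big by (cases "a = b") auto

lemma smooth_nets_net_diff:
  assumes "open \<Omega>" "u \<in> smooth_nets \<Omega>" "v \<in> smooth_nets \<Omega>"
  shows "net_diff u v \<in> smooth_nets \<Omega>"
  using assms by (auto simp: smooth_nets_def net_diff_def intro: Cinf_diff)

lemma moderate_imp_smooth: "u \<in> moderate \<Omega> \<Longrightarrow> u \<in> smooth_nets \<Omega>"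
  by (simp add: moderate_def)

text \<open>Applied with \<open>S = K\<close>, and with \<open>S = W m\<close> inside its closure
  \<open>K\<close>.\<close>

lemma supnorm_net_diff_le:
  fixes u v :: "('n::finite, 'k::real_normed_field) net"
  assumes "open \<Omega>" "u \<in> smooth_nets \<Omega>" "v \<in> smooth_nets \<Omega>" "compact K" "K \<subseteq> \<Omega>" "S \<subseteq> K"
    and "\<epsilon> \<in> {0<..1}"
  shows "supnorm S (mpartial \<beta> (net_diff u v \<epsilon>))
    \<le> supnorm S (mpartial \<beta> (u \<epsilon>)) + supnorm S (mpartial \<beta> (v \<epsilon>))"
proof (rule supnorm_diff_le)
  have C: "u \<epsilon> \<in> Cinf \<Omega>" "v \<epsilon> \<in> Cinf \<Omega>"
    using assms by (auto simp: smooth_nets_def)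
  thus "bounded (mpartial \<beta> (u \<epsilon>) ` S)" "bounded (mpartial \<beta> (v \<epsilon>) ` S)"
    using assms(4-6) by (auto intro: bounded_mpartial)
  show "mpartial \<beta> (net_diff u v \<epsilon>) x = mpartial \<beta> (u \<epsilon>) x - mpartial \<beta> (v \<epsilon>) x"
    if "x \<in> S" for x
    using mpartial_diff[OF assms(1) C] that assms(5,6) by (auto simp: net_diff_def)
qed

lemma moderate_net_diff:
  fixes u v :: "('n::finite, 'k::real_normed_field) net"
  assumes "open \<Omega>" "u \<in> moderate \<Omega>" "v \<in> moderate \<Omega>"
  shows "net_diff u v \<in> moderate \<Omega>"
  unfolding moderate_def
proof (intro CollectI conjI allI impI)
  note sm = assms(2,3)[THEN moderate_imp_smooth]
  show "net_diff u v \<in> smooth_nets \<Omega>"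
    using assms(1) sm by (rule smooth_nets_net_diff)
  fix K :: "(real^'n) set" and \<beta>
  assume K: "compact K \<and> K \<subseteq> \<Omega>"
  with assms obtain r s where r: "\<forall>\<^sub>F \<epsilon> in at_right 0. supnorm K (mpartial \<beta> (u \<epsilon>)) < \<epsilon> powr r"
    and s: "\<forall>\<^sub>F \<epsilon> in at_right 0. supnorm K (mpartial \<beta> (v \<epsilon>)) < \<epsilon> powr s"
    unfolding moderate_def by blast
  \<comment> \<open>One power of \<epsilon> is given away to absorb the factor 2 of the triangle
    inequality: for \<epsilon> < 1/2,
    \<open>2 * \<epsilon> powr (q + 1) \<le> \<epsilon> powr q\<close>.\<close>
  define q where "q = min r s - 1"
  have "\<forall>\<^sub>F \<epsilon>::real in at_right 0. \<epsilon> < 1/2"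
    using eventually_at_right_real[of 0 "1/2"] by (rule eventually_mono) auto
  hence "\<forall>\<^sub>F \<epsilon> in at_right 0. supnorm K (mpartial \<beta> (net_diff u v \<epsilon>)) < \<epsilon> powr q"
    using r s eventually_at_right_0_Ioc
  proof eventually_elim
    case (elim \<epsilon>)
    have "\<epsilon> powr r \<le> \<epsilon> powr (q + 1)" "\<epsilon> powr s \<le> \<epsilon> powr (q + 1)"
      using elim by (auto simp: q_def intro!: powr_mono')
    moreover have "2 * \<epsilon> powr (q + 1) \<le> \<epsilon> powr q"
      using elim by (simp add: powr_add)
    ultimately show ?case
      using supnorm_net_diff_le[OF assms(1) sm, of K K \<epsilon> \<beta>] K elim by auto
  qed
  thus "\<exists>r. \<forall>\<^sub>F \<epsilon> in at_right 0. supnorm K (mpartial \<beta> (net_diff u v \<epsilon>)) < \<epsilon> powr r" ..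
qed

text \<open>The suprema do not depend on \<epsilon>, while \<open>\<epsilon> powr (-1)\<close>
  exceeds every constant; so the exponent -1 serves all \<open>K\<close> and \<beta>.\<close>

lemma const_net_moderate:
  assumes "f \<in> Cinf \<Omega>"
  shows "(\<lambda>\<epsilon>. f) \<in> moderate \<Omega>"
proof -
  have "\<forall>\<^sub>F \<epsilon>::real in at_right 0. c < \<epsilon> powr (-1)" for c
  proof -
    have "filterlim (\<lambda>\<epsilon>::real. inverse \<epsilon>) at_top (at_right 0)"
      by (rule filterlim_inverse_at_top_right)
    hence "\<forall>\<^sub>F \<epsilon>::real in at_right 0. c < inverse \<epsilon>"
      by (simp add: filterlim_at_top_dense)
    thus ?thesis
      using eventually_at_right_0_Ioc by eventually_elim (simp add: powr_minus)
  qed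
  hence "\<exists>r. \<forall>\<^sub>F \<epsilon> in at_right 0. supnorm K (mpartial \<beta> f) < \<epsilon> powr r" for K \<beta>
    by blast
  thus ?thesis
    using assms by (simp add: moderate_def smooth_nets_def)
qed


section \<open>The valuations\<close>

lemma exhaustionD:
  assumes "exhaustion \<Omega> W"
  shows "compact (closure (W m))" "closure (W m) \<subseteq> \<Omega>" "W m \<subseteq> closure (W m)"
  using assms by (simp_all add: exhaustion_def closure_subset)

lemma bounded_mpartial_exhaustion:
  assumes "exhaustion \<Omega> W" "f \<in> Cinf \<Omega>"
  shows "bounded (mpartial \<beta> f ` closure (W m))" "bounded (mpartial \<beta> f ` W m)"
  using exhaustionD[OF assms(1)] by (intro bounded_mpartial[OF assms(2), of "closure (W m)"]; simp)+

text \<open>The metric uses only the diagonal \<open>m = p\<close>, so one index has to be large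
  enough both for the compact set and for a prescribed order of differentiation; hence the extra
  bound \<open>p \<le> m\<close>.\<close>

lemma exhaustion_compact_subset:
  assumes "exhaustion \<Omega> W" "compact K" "K \<subseteq> \<Omega>"
  obtains m where "p \<le> m" "K \<subseteq> W m"
proof -
  have step: "W i \<subseteq> W (Suc i)" and opn: "open (W i)" and un: "(\<Union>i. W i) = \<Omega>" for i
    using assms(1) by (simp_all add: exhaustion_def)
  have mono: "W i \<subseteq> W j" if "i \<le> j" for i j
    using step that by (rule lift_Suc_mono_le)
  obtain I where I: "I \<subseteq> UNIV" "finite I" "K \<subseteq> (\<Union>i\<in>I. W i)"
    using compactE_image[OF assms(2), of UNIV W] opn assms(3) un by metis
  let ?m = "Max (insert p I)"
  have "i \<le> ?m" if "i \<in> insert p I" for i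
    using that I(2) by (intro Max_ge) auto
  hence "p \<le> ?m" and "\<And>i. i \<in> I \<Longrightarrow> W i \<subseteq> W ?m"
    using mono by simp_all
  moreover from this(2) I(3) have "K \<subseteq> W ?m" by blast
  ultimately show ?thesis using that by blast
qed

text \<open>The admissible exponents are closed downwards, because \<open>\<epsilon> powr a\<close>
  is \<open>O(\<epsilon> powr c)\<close> for \<open>c \<le> a\<close>.\<close>

lemma less_valuationD:
  assumes "ereal c < valuation W m p u" "morder \<beta> \<le> p"
  shows "(\<lambda>\<epsilon>. supnorm (W m) (mpartial \<beta> (u \<epsilon>))) \<in> o[at_right 0](\<lambda>\<epsilon>. \<epsilon> powr c)"
proof -
  obtain a where "c < a"
    "(\<lambda>\<epsilon>. supnorm (W m) (mpartial \<beta> (u \<epsilon>))) \<in> o[at_right 0](\<lambda>\<epsilon>. \<epsilon> powr a)"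
    using assms unfolding valuation_def less_Sup_iff by auto
  thus ?thesis
    using landau_o.small_big_trans[OF _ powr_bigo_powr[of c a]] by auto
qed

lemma valuation_ge:
  assumes "\<And>\<beta>. morder \<beta> \<le> p \<Longrightarrow>
    (\<lambda>\<epsilon>. supnorm (W m) (mpartial \<beta> (u \<epsilon>))) \<in> o[at_right 0](\<lambda>\<epsilon>. \<epsilon> powr c)"
  shows "ereal c \<le> valuation W m p u"
  unfolding valuation_def using assms by (intro Sup_upper) auto

lemma finite_morder_le: "finite {\<beta> :: 'n::finite \<Rightarrow> nat. morder \<beta> \<le> p}"
proof (rule finite_subset)
  show "{\<beta> :: 'n \<Rightarrow> nat. morder \<beta> \<le> p} \<subseteq> (\<Pi>\<^sub>E i\<in>UNIV. {..p})"
  proof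
    fix \<beta> :: "'n \<Rightarrow> nat" assume "\<beta> \<in> {\<beta>. morder \<beta> \<le> p}"
    hence "morder \<beta> \<le> p" by simp
    moreover have "\<beta> i \<le> morder \<beta>" for i
      unfolding morder_def by (intro member_le_sum) auto
    ultimately have "\<beta> i \<le> p" for i
      by (rule le_trans[rotated])
    thus "\<beta> \<in> (\<Pi>\<^sub>E i\<in>UNIV. {..p})" by (simp add: PiE_iff)
  qed
qed (auto intro: finite_PiE)

text \<open>Only finitely many multi-indices have order at most \<open>p\<close>, so the growth
  exponents given by moderateness on the compact closure have a minimum.\<close>

lemma valuation_moderate:
  fixes u :: "('n::finite, 'k::real_normed_field) net"
  assumes "exhaustion \<Omega> W" "u \<in> moderate \<Omega>"
  shows "valuation W m p u \<noteq> -\<infinity>"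
proof -
  note W = exhaustionD[OF assms(1), of m]
  have "\<exists>r. \<forall>\<^sub>F \<epsilon> in at_right 0. supnorm (closure (W m)) (mpartial \<beta> (u \<epsilon>)) < \<epsilon> powr r" for \<beta>
    using assms(2) W unfolding moderate_def by blast
  then obtain r where r:
    "\<And>\<beta>. \<forall>\<^sub>F \<epsilon> in at_right 0. supnorm (closure (W m)) (mpartial \<beta> (u \<epsilon>)) < \<epsilon> powr r \<beta>"
    by metis
  \<comment> \<open>Subtracting 1 turns the big-O bounds into little-o bounds.\<close>
  define c where "c = Min (r ` {\<beta>. morder \<beta> \<le> p}) - 1"
  have "ereal c \<le> valuation W m p u"
  proof (rule valuation_ge)
    fix \<beta> :: "'n \<Rightarrow> nat"
    assume "morder \<beta> \<le> p"
    hence "c < r \<beta>"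
      unfolding c_def using Min_le[of "r ` {\<beta>. morder \<beta> \<le> p}" "r \<beta>"] finite_morder_le by fastforce
    have "(\<lambda>\<epsilon>. supnorm (W m) (mpartial \<beta> (u \<epsilon>))) \<in> O[at_right 0](\<lambda>\<epsilon>. \<epsilon> powr r \<beta>)"
    proof (rule bigoI[where c = 1])
      show "\<forall>\<^sub>F \<epsilon> in at_right 0.
        norm (supnorm (W m) (mpartial \<beta> (u \<epsilon>))) \<le> 1 * norm (\<epsilon> powr r \<beta>)"
        using r[of \<beta>] eventually_at_right_0_Ioc
      proof eventually_elim
        case (elim \<epsilon>)
        hence "u \<epsilon> \<in> Cinf \<Omega>"
          using moderate_imp_smooth[OF assms(2)] by (simp add: smooth_nets_def)
        note bdd = bounded_mpartial_exhaustion[OF assms(1) this, where \<beta> = \<beta> and m = m]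
        show ?case
          using elim supnorm_mono[OF bdd(1) W(3)] supnorm_nonneg[OF bdd(2)] by simp
      qed
    qed
    thus "(\<lambda>\<epsilon>. supnorm (W m) (mpartial \<beta> (u \<epsilon>))) \<in> o[at_right 0](\<lambda>\<epsilon>. \<epsilon> powr c)"
      using powr_smallo_powr[OF \<open>c < r \<beta>\<close>] landau_o.big_small_trans by blast
  qed
  thus ?thesis by auto
qed

text \<open>This is the source of the ultrametric inequality: u - w = (u - v) - (w - v), and a sum
  of two \<open>o(\<epsilon> powr c)\<close> terms is again one. Having \<open>w\<close> before
  \<open>v\<close> lets the symmetry of the distance be derived later.\<close>

lemma valuation_net_diff:
  fixes u v w :: "('n::finite, 'k::real_normed_field) net"
  assumes "open \<Omega>" "exhaustion \<Omega> W"
    and smooth: "u \<in> smooth_nets \<Omega>" "v \<in> smooth_nets \<Omega>" "w \<in> smooth_nets \<Omega>"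
  shows "min (valuation W m p (net_diff u v)) (valuation W m p (net_diff w v))
    \<le> valuation W m p (net_diff u w)"
proof (rule dense_le)
  note W = exhaustionD[OF assms(2), of m]
  fix e assume "e < min (valuation W m p (net_diff u v)) (valuation W m p (net_diff w v))"
  \<comment> \<open>Valuations may be infinite, but exponents are real; density supplies a real one
    in between.\<close>
  then obtain c where c: "e < ereal c"
    "ereal c < min (valuation W m p (net_diff u v)) (valuation W m p (net_diff w v))"
    using ereal_dense2 by blast
  have "ereal c \<le> valuation W m p (net_diff u w)"
  proof (rule valuation_ge)
    fix \<beta> :: "'n \<Rightarrow> nat"
    assume "morder \<beta> \<le> p"
    let ?s = "\<lambda>y \<epsilon>. supnorm (W m) (mpartial \<beta> (y \<epsilon>))"
    have "(\<lambda>\<epsilon>. ?s (net_diff u v) \<epsilon> + ?s (net_diff w v) \<epsilon>) \<in> o[at_right 0](\<lambda>\<epsilon>. \<epsilon> powr c)"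
      using less_valuationD[of c W m p _ \<beta>] c(2) \<open>morder \<beta> \<le> p\<close> by (intro sum_in_smallo) auto
    moreover have "?s (net_diff u w) \<in>
        O[at_right 0](\<lambda>\<epsilon>. ?s (net_diff u v) \<epsilon> + ?s (net_diff w v) \<epsilon>)"
    proof (rule bigoI[where c = 1])
      show "\<forall>\<^sub>F \<epsilon> in at_right 0. norm (?s (net_diff u w) \<epsilon>)
        \<le> 1 * norm (?s (net_diff u v) \<epsilon> + ?s (net_diff w v) \<epsilon>)"
        using eventually_at_right_0_Ioc
      proof eventually_elim
        case (elim \<epsilon>)
        have "net_diff u w = net_diff (net_diff u v) (net_diff w v)"
          by (simp add: net_diff_def)
        hence "?s (net_diff u w) \<epsilon> \<le> ?s (net_diff u v) \<epsilon> + ?s (net_diff w v) \<epsilon>"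
          using supnorm_net_diff_le[OF assms(1), of "net_diff u v" "net_diff w v"]
            smooth_nets_net_diff[OF assms(1)] smooth W elim by metis
        moreover have "net_diff u w \<epsilon> \<in> Cinf \<Omega>"
          using smooth_nets_net_diff[OF assms(1) smooth(1,3)] elim by (simp add: smooth_nets_def)
        hence "0 \<le> ?s (net_diff u w) \<epsilon>"
          by (intro supnorm_nonneg bounded_mpartial_exhaustion[OF assms(2)])
        ultimately show ?case by simp
      qed
    qed
    ultimately show "?s (net_diff u w) \<in> o[at_right 0](\<lambda>\<epsilon>. \<epsilon> powr c)"
      using landau_o.big_small_trans by blast
  qed
  thus "e \<le> valuation W m p (net_diff u w)"
    using c(1) by simp
qed

text \<open>Bounds on compact sets are traded for bounds on the exhaustion:
  \<open>closure (W m)\<close> is itself compact, and conversely every compact set and every order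
  of differentiation is captured by some diagonal index.\<close>

lemma negligible_iff_valuation:
  fixes u :: "('n::finite, 'k::real_normed_field) net"
  assumes "exhaustion \<Omega> W" and smooth: "u \<in> smooth_nets \<Omega>"
  shows "u \<in> negligible_nets \<Omega> \<longleftrightarrow> (\<forall>m. valuation W m m u = \<infinity>)"
proof
  assume neg: "u \<in> negligible_nets \<Omega>"
  show "\<forall>m. valuation W m m u = \<infinity>"
  proof (intro allI ereal_top valuation_ge)
    fix m and c :: real and \<beta> :: "'n \<Rightarrow> nat"
    note W = exhaustionD[OF assms(1), of m]
    \<comment> \<open>Negligibility speaks of natural exponents; a strictly larger one than
      \<open>c\<close> gives little-o.\<close>
    obtain r :: nat where "c < r" using reals_Archimedean2 by blast
    have "(\<lambda>\<epsilon>. supnorm (W m) (mpartial \<beta> (u \<epsilon>))) \<in> O[at_right 0](\<lambda>\<epsilon>. \<epsilon> powr r)"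
    proof (rule bigoI[where c = 1])
      have "\<forall>\<^sub>F \<epsilon> in at_right 0. supnorm (closure (W m)) (mpartial \<beta> (u \<epsilon>)) < \<epsilon> ^ r"
        using neg W unfolding negligible_nets_def by blast
      thus "\<forall>\<^sub>F \<epsilon> in at_right 0.
        norm (supnorm (W m) (mpartial \<beta> (u \<epsilon>))) \<le> 1 * norm (\<epsilon> powr r)"
        using eventually_at_right_0_Ioc
      proof eventually_elim
        case (elim \<epsilon>)
        hence "u \<epsilon> \<in> Cinf \<Omega>"
          using smooth by (simp add: smooth_nets_def)
        note bdd = bounded_mpartial_exhaustion[OF assms(1) this, where \<beta> = \<beta> and m = m]
        show ?case
          using elim supnorm_mono[OF bdd(1) W(3)] supnorm_nonneg[OF bdd(2)]
          by (simp add: powr_realpow)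
      qed
    qed
    thus "(\<lambda>\<epsilon>. supnorm (W m) (mpartial \<beta> (u \<epsilon>))) \<in> o[at_right 0](\<lambda>\<epsilon>. \<epsilon> powr c)"
      using powr_smallo_powr[OF \<open>c < r\<close>] landau_o.big_small_trans by blast
  qed
next
  assume val: "\<forall>m. valuation W m m u = \<infinity>"
  show "u \<in> negligible_nets \<Omega>"
    unfolding negligible_nets_def
  proof (intro CollectI conjI allI impI smooth)
    fix K :: "(real^'n) set" and \<beta> :: "'n \<Rightarrow> nat" and r :: nat
    assume K: "compact K \<and> K \<subseteq> \<Omega>"
    then obtain m where m: "morder \<beta> \<le> m" "K \<subseteq> W m"
      using exhaustion_compact_subset[OF assms(1)] by metis
    have "(\<lambda>\<epsilon>. supnorm (W m) (mpartial \<beta> (u \<epsilon>))) \<in> o[at_right 0](\<lambda>\<epsilon>. \<epsilon> powr r)"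
      using val m(1) by (intro less_valuationD) auto
    \<comment> \<open>A constant below 1 makes the resulting inequality strict, as
      \<open>\<epsilon> ^ r\<close> is positive.\<close>
    from landau_o.smallD[OF this, of "1/2"]
    have "\<forall>\<^sub>F \<epsilon> in at_right 0.
      norm (supnorm (W m) (mpartial \<beta> (u \<epsilon>))) \<le> 1/2 * norm (\<epsilon> powr r)" by simp
    thus "\<forall>\<^sub>F \<epsilon> in at_right 0. supnorm K (mpartial \<beta> (u \<epsilon>)) < \<epsilon> ^ r"
      using eventually_at_right_0_Ioc
    proof eventually_elim
      case (elim \<epsilon>)
      hence "u \<epsilon> \<in> Cinf \<Omega>"
        using smooth by (simp add: smooth_nets_def)
      hence "supnorm K (mpartial \<beta> (u \<epsilon>)) \<le> supnorm (W m) (mpartial \<beta> (u \<epsilon>))"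
        using m(2) by (intro supnorm_mono bounded_mpartial_exhaustion[OF assms(1)])
      moreover have "2 * \<bar>supnorm (W m) (mpartial \<beta> (u \<epsilon>))\<bar> \<le> \<epsilon> ^ r" "0 < \<epsilon> ^ r"
        using elim by (simp_all add: powr_realpow)
      ultimately show ?case by linarith
    qed
  qed
qed

lemma net_diff_self_negligible:
  assumes "open \<Omega>"
  shows "net_diff u u \<in> negligible_nets \<Omega>"
  unfolding negligible_nets_def
proof (intro CollectI conjI allI impI)
  show "net_diff u u \<in> smooth_nets \<Omega>"
    by (simp add: smooth_nets_def net_diff_def Cinf_const)
  fix K \<beta> and r :: nat
  assume "compact K \<and> K \<subseteq> \<Omega>"
  hence le: "supnorm K (mpartial \<beta> (net_diff u u \<epsilon>)) \<le> 0" for \<epsilon>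
    using mpartial_zero[OF assms] by (intro supnorm_le) (auto simp: net_diff_def)
  show "\<forall>\<^sub>F \<epsilon> in at_right 0. supnorm K (mpartial \<beta> (net_diff u u \<epsilon>)) < \<epsilon> ^ r"
    using eventually_at_right_0_Ioc
  proof eventually_elim
    case (elim \<epsilon>)
    hence "0 < \<epsilon> ^ r" by simp
    with le show ?case by (rule le_less_trans)
  qed
qed

section \<open>Valuations of constant nets\<close>

text \<open>A supremum independent of \<epsilon> is \<open>O(\<epsilon> powr 0)\<close>, hence
  \<open>o(\<epsilon> powr c)\<close> for every negative \<open>c\<close>.\<close>

lemma valuation_const_nonneg:
  fixes h :: "real^'n::finite \<Rightarrow> 'k::real_normed_field"
  shows "0 \<le> valuation W m p (\<lambda>\<epsilon>. h)"
proof (rule dense_le)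
  fix e :: ereal assume "e < 0"
  then obtain c where c: "e < ereal c" "ereal c < 0"
    using ereal_dense2 by blast
  have "ereal c \<le> valuation W m p (\<lambda>\<epsilon>. h)"
  proof (rule valuation_ge)
    fix \<beta> :: "'n \<Rightarrow> nat"
    have "(\<lambda>\<epsilon>::real. supnorm (W m) (mpartial \<beta> h)) \<in> O[at_right 0](\<lambda>\<epsilon>. \<epsilon> powr 0)"
    proof (rule bigoI)
      show "\<forall>\<^sub>F \<epsilon>::real in at_right 0. norm (supnorm (W m) (mpartial \<beta> h))
        \<le> \<bar>supnorm (W m) (mpartial \<beta> h)\<bar> * norm (\<epsilon> powr 0)"
        using eventually_at_right_0_Ioc by eventually_elim simp
    qed
    thus "(\<lambda>\<epsilon>. supnorm (W m) (mpartial \<beta> h)) \<in> o[at_right 0](\<lambda>\<epsilon>. \<epsilon> powr c)"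
      using powr_smallo_powr[of c 0] c(2) landau_o.big_small_trans by auto
  qed
  with c(1) show "e \<le> valuation W m p (\<lambda>\<epsilon>. h)" by simp
qed

text \<open>A positive valuation would make the exponent 0 admissible. The multi-index 0, allowed
  for every \<open>p\<close>, then yields a positive constant that tends to 0.\<close>

lemma valuation_const_eq_0:
  assumes "bounded (h ` W m)" "x \<in> W m" "h x \<noteq> 0"
  shows "valuation W m p (\<lambda>\<epsilon>. h) = 0"
proof (rule antisym[OF _ valuation_const_nonneg], rule ccontr)
  assume "\<not> valuation W m p (\<lambda>\<epsilon>. h) \<le> 0"
  hence "(\<lambda>\<epsilon>::real. supnorm (W m) h) \<in> o[at_right 0](\<lambda>\<epsilon>. \<epsilon> powr 0)"
    using less_valuationD[of 0 W m p "\<lambda>\<epsilon>. h" "\<lambda>i. 0"]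
    by (simp add: morder_def mpartial_order_zero zero_ereal_def)
  moreover have pos: "0 < supnorm (W m) h"
    using norm_le_supnorm[OF assms(1,2)] assms(3) by (meson less_le_trans zero_less_norm_iff)
  \<comment> \<open>Taking half of the constant as the little-o factor yields s \<le> s / 2 with s >
    0.\<close>
  ultimately have
    "\<forall>\<^sub>F \<epsilon>::real in at_right 0. norm (supnorm (W m) h) \<le> supnorm (W m) h / 2 * norm (\<epsilon> powr 0)"
    by (intro landau_o.smallD) auto
  hence "\<forall>\<^sub>F \<epsilon>::real in at_right 0. False"
    using eventually_at_right_0_Ioc by eventually_elim (use pos in auto)
  thus False by simp
qed


section \<open>The ultrametric\<close>

lemma seminorm_nonneg: "0 \<le> seminorm W m p u"
  by (simp add: seminorm_def)

lemma seminorm_eq_0_iff: "seminorm W m p u = 0 \<longleftrightarrow> valuation W m p u = \<infinity>"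
  by (simp add: seminorm_def)

text \<open>The value -\<infinity> must be excluded: \<open>real_of_ereal\<close> sends it to 0,
  which would give the seminorm 1 instead of \<infinity>.\<close>

lemma seminorm_antimono:
  assumes "valuation W m p u \<noteq> -\<infinity>" "valuation W m p u \<le> valuation W m p v"
  shows "seminorm W m p v \<le> seminorm W m p u"
  using assms unfolding seminorm_def
  by (cases "valuation W m p u"; cases "valuation W m p v") auto

lemma seminorm_net_diff:
  assumes "open \<Omega>" "exhaustion \<Omega> W" "u \<in> moderate \<Omega>" "v \<in> moderate \<Omega>" "w \<in> moderate \<Omega>"
  shows "seminorm W m p (net_diff u w)
    \<le> max (seminorm W m p (net_diff u v)) (seminorm W m p (net_diff w v))"
proof -
  have "min (valuation W m p (net_diff u v)) (valuation W m p (net_diff w v))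
      \<le> valuation W m p (net_diff u w)"
    using assms moderate_imp_smooth by (blast intro: valuation_net_diff)
  moreover have "valuation W m p (net_diff u v) \<noteq> -\<infinity>" "valuation W m p (net_diff w v) \<noteq> -\<infinity>"
    using assms moderate_net_diff valuation_moderate by blast+
  ultimately show ?thesis
    using seminorm_antimono[of W m p _ "net_diff u w"] by (simp add: le_max_iff_disj min_le_iff_disj) blast
qed

lemma mono_bounded_transform:
  assumes "0 \<le> s" "s \<le> t"
  shows "2 * s / (1 + s) \<le> 2 * t / (1 + t :: real)"
  using assms by (simp add: field_simps)

text \<open>Every term is at most 2, so the real supremum is a genuine one.\<close>

lemma net_dist_upper:
  "2 * seminorm W m m (net_diff u v) / (1 + seminorm W m m (net_diff u v)) \<le> net_dist W u v"
  unfolding net_dist_def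
proof (rule cSUP_upper)
  have "2 * seminorm W m m (net_diff u v) / (1 + seminorm W m m (net_diff u v)) \<le> 2" for m
    using seminorm_nonneg[of W m m "net_diff u v"] by (simp add: field_simps)
  thus "bdd_above (range (\<lambda>m.
      2 * seminorm W m m (net_diff u v) / (1 + seminorm W m m (net_diff u v))))"
    by (auto simp: bdd_above_def)
qed simp

lemma net_dist_least:
  assumes "\<And>m. 2 * seminorm W m m (net_diff u v) / (1 + seminorm W m m (net_diff u v)) \<le> c"
  shows "net_dist W u v \<le> c"
  unfolding net_dist_def using assms by (intro cSUP_least) auto

lemma net_dist_nonneg: "0 \<le> net_dist W u v"
  using net_dist_upper[of W 0 u v] seminorm_nonneg[of W 0 0 "net_diff u v"]
  by (meson add_nonneg_nonneg divide_nonneg_nonneg mult_nonneg_nonneg order_trans zero_le_numeral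
      zero_le_one)

text \<open>The supremum of the non-negative terms vanishes iff all seminorms do, that is, iff all
  diagonal valuations are infinite.\<close>

lemma net_dist_eq_0_iff:
  assumes "open \<Omega>" "exhaustion \<Omega> W" "u \<in> moderate \<Omega>" "v \<in> moderate \<Omega>"
  shows "net_dist W u v = 0 \<longleftrightarrow> (u, v) \<in> net_rel \<Omega>"
proof -
  have "net_dist W u v = 0 \<longleftrightarrow> (\<forall>m. seminorm W m m (net_diff u v) = 0)"
  proof
    assume "net_dist W u v = 0"
    thus "\<forall>m. seminorm W m m (net_diff u v) = 0"
      using net_dist_upper[of W _ u v] seminorm_nonneg[of W _ _ "net_diff u v"]
      by (auto simp: divide_le_0_iff intro!: antisym)
        (smt (verit))
  next
    assume "\<forall>m. seminorm W m m (net_diff u v) = 0"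
    hence "net_dist W u v \<le> 0"
      by (intro net_dist_least) simp
    thus "net_dist W u v = 0"
      using net_dist_nonneg by (intro antisym)
  qed
  also have "\<dots> \<longleftrightarrow> net_diff u v \<in> negligible_nets \<Omega>"
    using negligible_iff_valuation[OF assms(2)
        moderate_imp_smooth[OF moderate_net_diff[OF assms(1,3,4)]]]
    by (simp add: seminorm_eq_0_iff)
  finally show ?thesis
    using assms(3,4) by (simp add: net_rel_def)
qed

lemma net_dist_self:
  assumes "open \<Omega>" "exhaustion \<Omega> W" "u \<in> moderate \<Omega>"
  shows "net_dist W u u = 0"
  unfolding net_dist_eq_0_iff[OF assms assms(3)]
  using net_diff_self_negligible[OF assms(1)] assms(3) by (simp add: net_rel_def)

lemma net_dist_ultra:
  assumes "open \<Omega>" "exhaustion \<Omega> W" "u \<in> moderate \<Omega>" "v \<in> moderate \<Omega>" "w \<in> moderate \<Omega>"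
  shows "net_dist W u w \<le> max (net_dist W u v) (net_dist W w v)"
proof (rule net_dist_least)
  fix m
  let ?s = "\<lambda>u v. seminorm W m m (net_diff u v)"
  have "?s u w \<le> ?s u v \<or> ?s u w \<le> ?s w v"
    using seminorm_net_diff[OF assms] by (simp add: le_max_iff_disj)
  hence "2 * ?s u w / (1 + ?s u w) \<le> 2 * ?s u v / (1 + ?s u v) \<or>
      2 * ?s u w / (1 + ?s u w) \<le> 2 * ?s w v / (1 + ?s w v)"
    using mono_bounded_transform[OF seminorm_nonneg] by blast
  thus "2 * ?s u w / (1 + ?s u w) \<le> max (net_dist W u v) (net_dist W w v)"
    using net_dist_upper[of W m u v] net_dist_upper[of W m w v] by linarith
qed

text \<open>No negation of nets is involved: the ultrametric inequality through the point x itself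
  bounds the distance from x to y by the distance from y to x.\<close>

lemma net_dist_sym:
  fixes u v :: "('n::finite, 'k::real_normed_field) net"
  assumes "open \<Omega>" "exhaustion \<Omega> W" "u \<in> moderate \<Omega>" "v \<in> moderate \<Omega>"
  shows "net_dist W u v = net_dist W v u"
proof -
  have le: "net_dist W x y \<le> net_dist W y x" if "x \<in> moderate \<Omega>" "y \<in> moderate \<Omega>"
    for x y :: "('n, 'k) net"
    using net_dist_ultra[OF assms(1,2) that(1) that(1) that(2)]
      net_dist_self[OF assms(1,2) that(1)] net_dist_nonneg[of W y x] by simp
  show ?thesis using le[OF assms(3,4)] le[OF assms(4,3)] by (rule antisym)
qed

section \<open>The quotient and its metric\<close>

text \<open>Among moderate nets \<open>net_rel\<close> means distance 0, so symmetry and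
  transitivity are inherited from \<open>net_dist\<close>.\<close>

lemma equiv_net_rel:
  assumes "open \<Omega>" "exhaustion \<Omega> W"
  shows "equiv (moderate \<Omega> :: ('n::finite, 'k::real_normed_field) net set) (net_rel \<Omega>)"
proof (rule equivI)
  note zero = net_dist_eq_0_iff[OF assms]
  show "net_rel \<Omega> \<subseteq> (moderate \<Omega> :: ('n, 'k) net set) \<times> moderate \<Omega>"
    by (auto simp: net_rel_def)
  show "refl_on (moderate \<Omega> :: ('n, 'k) net set) (net_rel \<Omega>)"
    using net_diff_self_negligible[OF assms(1)] by (auto simp: refl_on_def net_rel_def)
  show "sym (net_rel \<Omega> :: (('n, 'k) net \<times> ('n, 'k) net) set)"
  proof (rule symI)
    fix u v :: "('n, 'k) net" assume uv: "(u, v) \<in> net_rel \<Omega>"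
    hence mod: "u \<in> moderate \<Omega>" "v \<in> moderate \<Omega>" by (auto simp: net_rel_def)
    show "(v, u) \<in> net_rel \<Omega>"
      using uv zero[OF mod] zero[OF mod(2,1)] net_dist_sym[OF assms mod] by simp
  qed
  show "trans (net_rel \<Omega> :: (('n, 'k) net \<times> ('n, 'k) net) set)"
  proof (rule transI)
    fix u v w :: "('n, 'k) net" assume uv: "(u, v) \<in> net_rel \<Omega>" "(v, w) \<in> net_rel \<Omega>"
    hence mod: "u \<in> moderate \<Omega>" "v \<in> moderate \<Omega>" "w \<in> moderate \<Omega>"
      by (auto simp: net_rel_def)
    hence "net_dist W u v = 0" "net_dist W w v = 0"
      using uv zero[OF mod(1,2)] zero[OF mod(2,3)] net_dist_sym[OF assms mod(2,3)] by simp_all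
    hence "net_dist W u w = 0"
      using net_dist_ultra[OF assms mod] net_dist_nonneg[of W u w] by simp
    thus "(u, w) \<in> net_rel \<Omega>"
      using zero[OF mod(1,3)] by simp
  qed
qed

lemma Colombeau_rep:
  assumes "open \<Omega>" "exhaustion \<Omega> W" "F \<in> Colombeau \<Omega>"
  shows "(SOME u. u \<in> F) \<in> moderate \<Omega>" "net_rel \<Omega> `` {SOME u. u \<in> F} = F"
proof -
  note eq = equiv_net_rel[OF assms(1,2)]
  have F: "F \<in> moderate \<Omega> // net_rel \<Omega>"
    using assms(3) by (simp add: Colombeau_def)
  have "(SOME u. u \<in> F) \<in> F"
    using in_quotient_imp_non_empty[OF eq F] by (simp add: some_in_eq)
  thus "(SOME u. u \<in> F) \<in> moderate \<Omega>"
    using in_quotient_imp_subset[OF eq F] by blast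
  obtain u where u: "F = net_rel \<Omega> `` {u}"
    using F by (rule quotientE)
  with \<open>(SOME u. u \<in> F) \<in> F\<close> have "(u, SOME u. u \<in> F) \<in> net_rel \<Omega>" by blast
  from equiv_class_eq[OF eq this] u show "net_rel \<Omega> `` {SOME u. u \<in> F} = F" by blast
qed

text \<open>This is independence of the representatives, which frees the distance from the choice in
  its definition.\<close>

lemma Colombeau_dist_classes:
  fixes u v :: "('n::finite, 'k::real_normed_field) net"
  assumes "open \<Omega>" "exhaustion \<Omega> W" "u \<in> moderate \<Omega>" "v \<in> moderate \<Omega>"
  shows "Colombeau_dist W (net_rel \<Omega> `` {u}) (net_rel \<Omega> `` {v}) = net_dist W u v"
proof -
  note eq = equiv_net_rel[OF assms(1,2)]
  define u' v' where "u' = (SOME x. x \<in> net_rel \<Omega> `` {u})" and "v' = (SOME x. x \<in> net_rel \<Omega> `` {v})"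
  have "u' \<in> net_rel \<Omega> `` {u}"
    unfolding u'_def using equiv_class_self[OF eq assms(3)]
    by (rule someI[where P = "\<lambda>x. x \<in> net_rel \<Omega> `` {u}"])
  moreover have "v' \<in> net_rel \<Omega> `` {v}"
    unfolding v'_def using equiv_class_self[OF eq assms(4)]
    by (rule someI[where P = "\<lambda>x. x \<in> net_rel \<Omega> `` {v}"])
  ultimately have rel: "(u, u') \<in> net_rel \<Omega>" "(v, v') \<in> net_rel \<Omega>" by auto
  hence mod: "u' \<in> moderate \<Omega>" "v' \<in> moderate \<Omega>" by (auto simp: net_rel_def)
  note zero = net_dist_eq_0_iff[OF assms(1,2)] and ultra = net_dist_ultra[OF assms(1,2)]
    and sym = net_dist_sym[OF assms(1,2)]
  \<comment> \<open>The ultrametric inequality, used in both directions, shows that moving the first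
    argument by distance 0 changes nothing; symmetry transfers this to the second.\<close>
  have left: "net_dist W x z = net_dist W y z"
    if "(x, y) \<in> net_rel \<Omega>" "x \<in> moderate \<Omega>" "y \<in> moderate \<Omega>" "z \<in> moderate \<Omega>"
    for x y z :: "('n, 'k) net"
  proof -
    have "net_dist W x y = 0" "net_dist W y x = 0"
      using zero[OF that(2,3)] sym[OF that(2,3)] that(1) by simp_all
    thus ?thesis
      using ultra[OF that(2,3,4)] ultra[OF that(3,2,4)] sym[OF that(2,4)] sym[OF that(3,4)]
        net_dist_nonneg[of W x z] net_dist_nonneg[of W y z] by simp
  qed
  have "net_dist W u v = net_dist W u' v"
    by (rule left) (fact rel mod assms(3,4))+
  also have "\<dots> = net_dist W v u'"
    by (rule sym) (fact mod assms(4))+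
  also have "\<dots> = net_dist W v' u'"
    by (rule left) (fact rel mod assms(4))+
  also have "\<dots> = net_dist W u' v'"
    by (rule sym) (fact mod)+
  finally have "net_dist W u v = net_dist W u' v'" .
  thus ?thesis
    by (simp add: Colombeau_dist_def u'_def v'_def)
qed

text \<open>The strong triangle inequality is kept as a separate fact, because the bound on the
  inductive dimension rests on it.\<close>

lemma Colombeau_metric:
  assumes "open \<Omega>" "exhaustion \<Omega> W"
  shows "Metric_space (Colombeau \<Omega> :: ('n::finite, 'k::real_normed_field) net set set)
      (restrict_dist (Colombeau \<Omega>) (Colombeau_dist W))"
    and "\<And>F G H :: ('n, 'k) net set. F \<in> Colombeau \<Omega> \<Longrightarrow> G \<in> Colombeau \<Omega> \<Longrightarrow> H \<in> Colombeau \<Omega> \<Longrightarrow>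
      Colombeau_dist W F H \<le> max (Colombeau_dist W F G) (Colombeau_dist W G H)"
proof -
  let ?C = "Colombeau \<Omega> :: ('n, 'k) net set set" and ?d = "Colombeau_dist W"
  note rep = Colombeau_rep[OF assms]
  have sym: "?d F G = ?d G F" if "F \<in> ?C" "G \<in> ?C" for F G
    unfolding Colombeau_dist_def using that rep(1) by (intro net_dist_sym[OF assms])
  show ultra: "?d F H \<le> max (?d F G) (?d G H)" if "F \<in> ?C" "G \<in> ?C" "H \<in> ?C" for F G H
    using net_dist_ultra[OF assms that[THEN rep(1)]] sym[OF that(2,3)]
    by (simp add: Colombeau_dist_def)
  have nonneg: "0 \<le> ?d F G" for F G :: "('n, 'k) net set"
    by (simp add: Colombeau_dist_def net_dist_nonneg)
  have zero: "?d F G = 0 \<longleftrightarrow> F = G" if "F \<in> ?C" "G \<in> ?C" for F G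
  proof -
    have "?d F G = 0 \<longleftrightarrow> ((SOME u. u \<in> F), (SOME v. v \<in> G)) \<in> net_rel \<Omega>"
      unfolding Colombeau_dist_def using that rep(1) by (intro net_dist_eq_0_iff[OF assms])
    also have "\<dots> \<longleftrightarrow> F = G"
      using eq_equiv_class_iff[OF equiv_net_rel[OF assms] that[THEN rep(1)]] that[THEN rep(2)]
      by simp
    finally show ?thesis .
  qed
  show "Metric_space ?C (restrict_dist ?C ?d)"
  proof
    show "0 \<le> restrict_dist ?C ?d F G" for F G
      using nonneg by (simp add: restrict_dist_def)
    show "restrict_dist ?C ?d F G = restrict_dist ?C ?d G F" for F G
      using sym by (auto simp: restrict_dist_def)
    show "restrict_dist ?C ?d F G = 0 \<longleftrightarrow> F = G" if "F \<in> ?C" "G \<in> ?C" for F G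
      using zero that by (simp add: restrict_dist_def)
    show "restrict_dist ?C ?d F H \<le> restrict_dist ?C ?d F G + restrict_dist ?C ?d G H"
      if "F \<in> ?C" "G \<in> ?C" "H \<in> ?C" for F G H
      using ultra[OF that] nonneg[of F G] nonneg[of G H] that by (simp add: restrict_dist_def)
  qed
qed

text \<open>All seminorms of the constant net \<open>f - g\<close> are at most 1, and the value 1 is
  attained at any \<open>m\<close> with \<open>x \<in> W m\<close>.\<close>

lemma Colombeau_dist_diag_embed:
  fixes f g :: "real^'n::finite \<Rightarrow> 'k::real_normed_field"
  assumes "open \<Omega>" "exhaustion \<Omega> W" "f \<in> Cinf \<Omega>" "g \<in> Cinf \<Omega>" "x \<in> \<Omega>" "f x \<noteq> g x"
  shows "Colombeau_dist W (diag_embed \<Omega> f) (diag_embed \<Omega> g) = 1"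
proof -
  define h where "h = (\<lambda>x. f x - g x)"
  have h: "net_diff (\<lambda>\<epsilon>. f) (\<lambda>\<epsilon>. g) = (\<lambda>\<epsilon>. h)"
    by (simp add: h_def net_diff_def)
  have "Colombeau_dist W (diag_embed \<Omega> f) (diag_embed \<Omega> g) = net_dist W (\<lambda>\<epsilon>. f) (\<lambda>\<epsilon>. g)"
    unfolding diag_embed_def using assms const_net_moderate
    by (blast intro: Colombeau_dist_classes)
  also have "\<dots> = 1"
  proof (rule antisym)
    have le: "seminorm W m m (\<lambda>\<epsilon>. h) \<le> 1" for m
      using valuation_const_nonneg[of W m m h]
      by (simp add: seminorm_def real_of_ereal_pos)
    show "net_dist W (\<lambda>\<epsilon>. f) (\<lambda>\<epsilon>. g) \<le> 1"
      using mono_bounded_transform[OF seminorm_nonneg le] by (intro net_dist_least) (simp add: h)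
    obtain m where m: "x \<in> W m"
      using assms(2,5) by (auto simp: exhaustion_def)
    have "h \<in> Cinf \<Omega>"
      unfolding h_def using assms by (intro Cinf_diff)
    hence "bounded (mpartial (\<lambda>i. 0) h ` W m)"
      by (rule bounded_mpartial_exhaustion[OF assms(2)])
    hence "seminorm W m m (\<lambda>\<epsilon>. h) = 1"
      using m assms(6) valuation_const_eq_0[of h W m x m]
      by (simp add: seminorm_def mpartial_order_zero h_def)
    thus "1 \<le> net_dist W (\<lambda>\<epsilon>. f) (\<lambda>\<epsilon>. g)"
      using net_dist_upper[of W m "\<lambda>\<epsilon>. f" "\<lambda>\<epsilon>. g"] by (simp add: h)
  qed
  finally show ?thesis .
qed


section \<open>Dimensions\<close>

text \<open>The union \<open>U\<close> of balls around the points of \<open>A\<close> inside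
  \<open>V\<close> is clopen, so its frontier is empty. Balls are clopen here, but an infinite union
  of them need not be closed; closedness of \<open>U\<close> uses that \<open>A\<close> is
  closed.\<close>

lemma (in Metric_space) Ind_le_0_ultrametric:
  assumes ultra: "\<And>x y z. x \<in> M \<Longrightarrow> y \<in> M \<Longrightarrow> z \<in> M \<Longrightarrow> d x z \<le> max (d x y) (d y z)"
  shows "Ind_le mtopology 0"
proof (rule Ind_le.step)
  fix A V
  assume A: "closedin mtopology A" and V: "openin mtopology V" and "A \<subseteq> V"
  have "\<exists>r>0. mball a r \<subseteq> V" if "a \<in> A" for a
    using V \<open>A \<subseteq> V\<close> that by (auto simp: openin_mtopology)
  then obtain r where r: "\<And>a. a \<in> A \<Longrightarrow> 0 < r a" "\<And>a. a \<in> A \<Longrightarrow> mball a (r a) \<subseteq> V"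
    by metis
  have AM: "A \<subseteq> M"
    using A closedin_subset by fastforce
  define U where "U = (\<Union>a\<in>A. mball a (r a))"
  have "openin mtopology U"
    unfolding U_def by (intro openin_Union) auto
  moreover have "A \<subseteq> U"
    unfolding U_def using AM r(1) by (force simp: centre_in_mball_iff)
  moreover have "U \<subseteq> V"
    unfolding U_def using r(2) by auto
  moreover have "closedin mtopology U"
    unfolding closedin_metric
  proof (intro conjI allI impI)
    show "U \<subseteq> M" unfolding U_def by auto
    fix x assume x: "x \<in> M - U"
    hence "x \<in> M - A" using \<open>A \<subseteq> U\<close> by blast
    then obtain \<rho> where \<rho>: "0 < \<rho>" "disjnt A (mball x \<rho>)"
      using A unfolding closedin_metric by blast
    \<comment> \<open>If the two balls met in \<open>y\<close>, the distance of \<open>a\<close> and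
      \<open>x\<close> would be at most the larger of their distances to \<open>y\<close>. It would
      then be below \<open>r a\<close>, putting \<open>x\<close> into \<open>U\<close>, or below
      \<rho>, putting \<open>a\<close> into the ball around \<open>x\<close>.\<close>
    have meet: False if a: "a \<in> A" and y: "y \<in> mball a (r a)" "y \<in> mball x \<rho>" for a y
    proof -
      have "d a x \<le> max (d a y) (d y x)" "d x a \<le> max (d x y) (d y a)"
        using a x y AM by (auto intro!: ultra)
      moreover have "d y x = d x y" "d y a = d a y" "d x a = d a x"
        by (simp_all add: commute)
      moreover have "a \<notin> mball x \<rho>" "x \<notin> mball a (r a)"
        using \<rho>(2) a x by (auto simp: disjnt_iff U_def)
      hence "\<not> d x a < \<rho>" "\<not> d a x < r a"
        using a x AM by auto
      ultimately show False
        using y by auto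
    qed
    have "disjnt U (mball x \<rho>)"
      unfolding disjnt_iff U_def using meet by blast
    thus "\<exists>r>0. disjnt U (mball x r)"
      using \<rho>(1) by blast
  qed
  ultimately have "openin mtopology U \<and> A \<subseteq> U \<and> U \<subseteq> V \<and> mtopology frontier_of U = {}"
    by (metis clopenin_eq_frontier_of)
  moreover have "Ind_le (subtopology mtopology {}) (0 - 1)"
    using Ind_le.empty[of "subtopology mtopology {}"] by simp
  ultimately show "\<exists>U. openin mtopology U \<and> A \<subseteq> U \<and> U \<subseteq> V \<and>
      Ind_le (subtopology mtopology (mtopology frontier_of U)) (0 - 1)"
    by metis
qed simp

text \<open>A set of diameter at most \<open>c / 2\<close> contains at most one point of
  \<open>S\<close>, so countably many such sets cannot cover the uncountable
  \<open>S\<close>.\<close>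

lemma Hausdorff_dim_eq_infinity:
  assumes "S \<subseteq> M" "uncountable S" "0 < c"
    and sep: "\<And>x y. x \<in> S \<Longrightarrow> y \<in> S \<Longrightarrow> x \<noteq> y \<Longrightarrow> c \<le> d x y"
  shows "Hausdorff_dim M d = \<infinity>"
proof -
  have no_cover: "\<not> M \<subseteq> (\<Union>i. U i)" if U: "\<And>i. mdiam d (U i) \<le> ennreal (c / 2)"
    for U :: "nat \<Rightarrow> 'a set"
  proof
    assume cover: "M \<subseteq> (\<Union>i. U i)"
    have single: "x = y" if xy: "x \<in> S \<inter> U i" "y \<in> S \<inter> U i" for x y i
    proof (rule ccontr)
      assume "x \<noteq> y"
      have "ennreal c \<le> ennreal (d x y)"
        using xy sep[OF _ _ \<open>x \<noteq> y\<close>] by (intro ennreal_leI) auto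
      also have "\<dots> \<le> mdiam d (U i)"
        unfolding mdiam_def using xy by (intro SUP_upper2[of x] SUP_upper2[of y]) auto
      also have "\<dots> \<le> ennreal (c / 2)" by (rule U)
      finally show False using \<open>0 < c\<close> by simp
    qed
    have ctb: "countable (S \<inter> U i)" for i
    proof (cases "S \<inter> U i = {}")
      case False
      then obtain x where "x \<in> S \<inter> U i" by blast
      hence "S \<inter> U i \<subseteq> {x}" using single by blast
      thus ?thesis by (rule countable_subset) simp
    qed simp
    have "countable (\<Union>i. S \<inter> U i)"
      by (intro countable_UN ctb countableI_type)
    moreover have "S = (\<Union>i. S \<inter> U i)"
      using cover assms(1) by blast
    ultimately show False
      using assms(2) by simp
  qed
  have "Hausdorff_measure M d s = \<infinity>" for s
  proof -
    \<comment> \<open>There are no admissible covers at this scale, and the infimum of the empty set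
      is \<infinity>.\<close>
    have "Hausdorff_pre M d s (c / 2) = \<infinity>"
      unfolding Hausdorff_pre_def using no_cover by (auto simp: Inf_top_conv infinity_ennreal_def)
    moreover have "Hausdorff_pre M d s (c / 2) \<le> Hausdorff_measure M d s"
      unfolding Hausdorff_measure_def using \<open>0 < c\<close> by (intro SUP_upper) auto
    ultimately show ?thesis by (simp add: top_unique)
  qed
  \<comment> \<open>No exponent has measure 0, so the dimension is again an infimum over the empty
    set.\<close>
  thus ?thesis
    by (simp add: Hausdorff_dim_def top_ereal_def)
qed


theorem corollary2:
  fixes \<Omega> :: "(real^'n::finite) set"
    and W :: "nat \<Rightarrow> (real^'n) set"
  assumes "open \<Omega>" and "\<Omega> \<noteq> {}" and "exhaustion \<Omega> W"
  shows "(\<forall>f\<in>Cinf \<Omega> :: (real^'n \<Rightarrow> 'k::real_normed_field) set. diag_embed \<Omega> f \<in> Colombeau \<Omega>) \<and>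
    (\<exists>c>0. \<forall>f\<in>Cinf \<Omega> :: (real^'n \<Rightarrow> 'k) set. \<forall>g\<in>Cinf \<Omega>.
       (\<exists>x\<in>\<Omega>. f x \<noteq> g x) \<longrightarrow> Colombeau_dist W (diag_embed \<Omega> f) (diag_embed \<Omega> g) = c) \<and>
    fractal (Colombeau \<Omega> :: ('n, 'k) net set set) (Colombeau_dist W)"
proof (intro conjI)
  let ?C = "Colombeau \<Omega> :: ('n, 'k) net set set"
  have embed: "diag_embed \<Omega> f \<in> ?C" if "f \<in> Cinf \<Omega>" for f
    unfolding Colombeau_def diag_embed_def using const_net_moderate[OF that] by (rule quotientI)
  thus "\<forall>f\<in>Cinf \<Omega>. diag_embed \<Omega> f \<in> ?C" by blast
  note dist = Colombeau_dist_diag_embed[OF assms(1,3)]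
  show "\<exists>c>0. \<forall>f\<in>Cinf \<Omega> :: (real^'n \<Rightarrow> 'k) set. \<forall>g\<in>Cinf \<Omega>.
       (\<exists>x\<in>\<Omega>. f x \<noteq> g x) \<longrightarrow> Colombeau_dist W (diag_embed \<Omega> f) (diag_embed \<Omega> g) = c"
    using dist by (intro exI[of _ 1]) auto
  show "fractal ?C (Colombeau_dist W)"
    unfolding fractal_def
  proof
    let ?d = "restrict_dist ?C (Colombeau_dist W)"
    show "Metric_space ?C ?d"
      by (rule Colombeau_metric[OF assms(1,3)])
    then interpret Metric_space ?C ?d .
    have "Ind_le mtopology 0"
      using Colombeau_metric(2)[OF assms(1,3)]
      by (intro Ind_le_0_ultrametric) (simp add: restrict_dist_def)
    hence "Ind mtopology \<le> 0"
      unfolding Ind_def by (intro Inf_lower) (auto simp: image_iff zero_ereal_def)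
    \<comment> \<open>Constants from the embedded reals give uncountably many smooth functions over
      any scalar field \<open>'k\<close>; distinct ones differ at the point \<open>x\<close> of the
      non-empty \<Omega>.\<close>
    define e where "e t = diag_embed \<Omega> (\<lambda>x::real^'n. of_real t :: 'k)" for t
    obtain x where "x \<in> \<Omega>" using assms(2) by blast
    have e_dist: "Colombeau_dist W (e s) (e t) = 1" if "s \<noteq> t" for s t
      unfolding e_def using \<open>x \<in> \<Omega>\<close> that by (intro dist Cinf_const) auto
    have e_mem: "e t \<in> ?C" for t
      unfolding e_def by (intro embed Cinf_const)
    have "inj e"
    \<comment> \<open>Distinct parameters have classes at distance 1, whereas equal classes have
      distance 0.\<close>
    proof (rule injI, rule ccontr)
      fix s t assume "e s = e t" "s \<noteq> t"
      hence "?d (e t) (e t) = 1"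
        using e_dist[of s t] e_mem by (simp add: restrict_dist_def)
      moreover have "?d (e t) (e t) = 0"
        using e_mem by (rule mdist_zero)
      ultimately show False by linarith
    qed
    hence "uncountable (range e)"
      using uncountable_UNIV_real countable_image_inj_on by blast
    hence "Hausdorff_dim ?C (Colombeau_dist W) = \<infinity>"
    proof (rule Hausdorff_dim_eq_infinity[rotated])
      show "range e \<subseteq> ?C" using e_mem by blast
      show "1 \<le> Colombeau_dist W F G" if "F \<in> range e" "G \<in> range e" "F \<noteq> G" for F G
        using that e_dist by (metis order_refl rangeE)
    qed simp
    with \<open>Ind mtopology \<le> 0\<close> show "Ind mtopology < Hausdorff_dim ?C (Colombeau_dist W)"
      by auto
  qed
qed

end
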